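(* Let $p$ be a prime and let $A$ be a finite abelian $p$-group. For the group $G = A \rtimes_{-1} C_2$ we have $$\mathsf{E}(G)\le \frac{3}{2}|G|.$$
   Context: Groups are written multiplicatively with identity $1$. $A \rtimes_{-1} C_2$ is the semidirect product in which the generator $h$ of $C_2$ (of order $2$) acts on $A$ by inversion: $hah^{-1}=a^{-1}$ for all $a\in A$. A sequence over a finite group $G$ is a finite unordered multiset of elements of $G$; its length $|S|$ is the number of terms counted with multiplicity; a subsequence is a sub-multiset. For $S=g_1\cdot g_2\cdots g_\ell$, $\pi(S)=\{\prod_{i=1}^{\ell} g_{\sigma(i)} : \sigma\in\mathfrak{S}_\ell\}$ is the set of products of all its terms in all possible orders, and for $r\in\{1,\dots,\ell\}$, $\Pi_r(S)=\bigcup_{T\mid S,\ |T|=r}\pi(T)$ is the union over subsequences $T$ of $S$ of length $r$. The Gao constant $\mathsf{E}(G)$ is the least $k\in\mathbb{N}$ such that every sequence $S$ over $G$ with $|S|\ge k$ satisfies $1\in\Pi_{|G|}(S)$, i.e. $S$ has a subsequence of length exactly $|G|$ whose terms can be ordered so that their product is $1$. *)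

theory Defs
  imports "HOL-Computational_Algebra.Primes" "HOL-Library.Multiset" "HOL-Algebra.Elementary_Groups" "HOL-Algebra.Multiplicative_Group"
begin

definition p_group :: "nat \<Rightarrow> ('a, 'b) monoid_scheme \<Rightarrow> bool" where
  "p_group p A \<longleftrightarrow> group A \<and> (\<forall>a\<in>carrier A. \<exists>n. group.ord A a = p ^ n)"

definition semidirect_product ::
  "('a, 'c) monoid_scheme \<Rightarrow> ('b, 'd) monoid_scheme \<Rightarrow> ('b \<Rightarrow> 'a \<Rightarrow> 'a) \<Rightarrow> ('a \<times> 'b) monoid" where
  "semidirect_product N H \<phi> =
    \<lparr>carrier = carrier N \<times> carrier H,
     monoid.mult = (\<lambda>(a, h) (b, k). (a \<otimes>\<^bsub>N\<^esub> \<phi> h b, h \<otimes>\<^bsub>H\<^esub> k)),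
     one = (\<one>\<^bsub>N\<^esub>, \<one>\<^bsub>H\<^esub>)\<rparr>"

text \<open>The cyclic group of order 2 is \<open>integer_mod_group 2\<close>, with carrier \<open>{0, 1}\<close> and
  generator \<open>1\<close>.\<close>

definition inversion_action :: "('a, 'c) monoid_scheme \<Rightarrow> int \<Rightarrow> 'a \<Rightarrow> 'a" where
  "inversion_action A h a = (if h = 0 then a else inv\<^bsub>A\<^esub> a)"

definition generalized_dihedral :: "('a, 'c) monoid_scheme \<Rightarrow> ('a \<times> int) monoid" where
  "generalized_dihedral A = semidirect_product A (integer_mod_group 2) (inversion_action A)"

text \<open>Sequences are multisets, ordered by listing them; \<open>seq_products G S\<close> is \<open>\<pi>(S)\<close> and
  \<open>subseq_products G r S\<close> is \<open>\<Pi>\<^sub>r(S)\<close>.\<close>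

definition seq_over :: "('a, 'b) monoid_scheme \<Rightarrow> 'a multiset \<Rightarrow> bool" where
  "seq_over G S \<longleftrightarrow> set_mset S \<subseteq> carrier G"

definition seq_products :: "('a, 'b) monoid_scheme \<Rightarrow> 'a multiset \<Rightarrow> 'a set" where
  "seq_products G S = {foldr (\<otimes>\<^bsub>G\<^esub>) xs \<one>\<^bsub>G\<^esub> | xs. mset xs = S}"

definition subseq_products :: "('a, 'b) monoid_scheme \<Rightarrow> nat \<Rightarrow> 'a multiset \<Rightarrow> 'a set" where
  "subseq_products G r S = (\<Union>T\<in>{T. T \<subseteq># S \<and> size T = r}. seq_products G T)"

definition gao_bound :: "('a, 'b) monoid_scheme \<Rightarrow> nat \<Rightarrow> bool" where
  "gao_bound G k \<longleftrightarrow>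
    (\<forall>S. seq_over G S \<and> size S \<ge> k \<longrightarrow> \<one>\<^bsub>G\<^esub> \<in> subseq_products G (order G) S)"

definition gao_constant :: "('a, 'b) monoid_scheme \<Rightarrow> nat" where
  "gao_constant G = (LEAST k. gao_bound G k)"

text \<open>The minimum exists for every finite group, by the pigeonhole principle.\<close>

lemma gao_bound_exists:
  assumes "group G" "finite (carrier G)"
  shows "gao_bound G (order G * order G)"
  unfolding gao_bound_def
proof (intro allI impI, elim conjE)
  interpret group G by fact
  fix S assume S: "seq_over G S" and len: "size S \<ge> order G * order G"
  have "\<exists>g\<in>carrier G. count S g \<ge> order G"
  proof (rule ccontr)
    assume "\<not> ?thesis"
    then have "(\<Sum>g\<in>carrier G. count S g) < (\<Sum>g\<in>carrier G. order G)"
      using assms(2) one_closed by (intro sum_strict_mono) auto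
    moreover have "size S = (\<Sum>g\<in>carrier G. count S g)"
      unfolding size_multiset_overloaded_eq using S assms(2)
      by (intro sum.mono_neutral_left) (auto simp: seq_over_def not_in_iff)
    ultimately show False using len by (simp add: order_def)
  qed
  then obtain g where g: "g \<in> carrier G" "count S g \<ge> order G" by blast
  have "foldr (\<otimes>\<^bsub>G\<^esub>) (replicate n g) \<one>\<^bsub>G\<^esub> = g [^]\<^bsub>G\<^esub> n" for n
  proof (induction n)
    case (Suc n)
    then show ?case by (simp only: replicate_Suc foldr.simps o_apply nat_pow_Suc2[OF g(1)])
  qed simp
  then have "\<one>\<^bsub>G\<^esub> = foldr (\<otimes>\<^bsub>G\<^esub>) (replicate (order G) g) \<one>\<^bsub>G\<^esub>"
    using g(1) pow_order_eq_1 by simp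
  then have "\<one>\<^bsub>G\<^esub> \<in> seq_products G (replicate_mset (order G) g)"
    unfolding seq_products_def mem_Collect_eq
    by (intro exI[of _ "replicate (order G) g"] conjI) (simp_all only: mset_replicate)
  moreover have "replicate_mset (order G) g \<subseteq># S"
    using g(2) by (simp add: count_le_replicate_mset_subset_eq)
  ultimately show "\<one>\<^bsub>G\<^esub> \<in> subseq_products G (order G) S"
    unfolding subseq_products_def by (intro UN_I[of "replicate_mset (order G) g"]) simp_all
qed

lemma gao_constant_bound:
  assumes "group G" "finite (carrier G)"
  shows "gao_bound G (gao_constant G)"
  unfolding gao_constant_def using gao_bound_exists[OF assms] by (rule LeastI)

lemma gao_constant_le:
  assumes "gao_bound G k"
  shows "gao_constant G \<le> k"
  unfolding gao_constant_def using assms by (rule Least_le)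

lemma carrier_generalized_dihedral: "carrier (generalized_dihedral A) = carrier A \<times> {0, 1}"
  by (auto simp: generalized_dihedral_def semidirect_product_def carrier_integer_mod_group)

lemma order_generalized_dihedral: "order (generalized_dihedral A) = 2 * order A"
  by (simp add: order_def carrier_generalized_dihedral card_cartesian_product)

lemma group_generalized_dihedral:
  assumes "comm_group A"
  shows "group (generalized_dihedral A)"
proof -
  interpret comm_group A by fact
  show ?thesis
  proof (rule groupI)
    fix x assume "x \<in> carrier (generalized_dihedral A)"
    then obtain a h where x: "x = (a, h)" "a \<in> carrier A" "h = 0 \<or> h = 1"
      by (auto simp: carrier_generalized_dihedral)
    have "(if h = 0 then inv\<^bsub>A\<^esub> a else a, h) \<otimes>\<^bsub>generalized_dihedral A\<^esub> x = \<one>\<^bsub>generalized_dihedral A\<^esub>"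
      using x by (auto simp: generalized_dihedral_def semidirect_product_def inversion_action_def)
    then show "\<exists>y\<in>carrier (generalized_dihedral A).
        y \<otimes>\<^bsub>generalized_dihedral A\<^esub> x = \<one>\<^bsub>generalized_dihedral A\<^esub>"
      using x by (intro bexI) (auto simp: carrier_generalized_dihedral)
  next
    fix x y z
    assume "x \<in> carrier (generalized_dihedral A)" "y \<in> carrier (generalized_dihedral A)"
      "z \<in> carrier (generalized_dihedral A)"
    then obtain a h b k c l where xyz: "x = (a, h)" "y = (b, k)" "z = (c, l)"
      and A: "a \<in> carrier A" "b \<in> carrier A" "c \<in> carrier A"
      and h: "h = 0 \<or> h = 1" and k: "k = 0 \<or> k = 1"
      by (auto simp: carrier_generalized_dihedral)
    show "x \<otimes>\<^bsub>generalized_dihedral A\<^esub> y \<otimes>\<^bsub>generalized_dihedral A\<^esub> z =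
        x \<otimes>\<^bsub>generalized_dihedral A\<^esub> (y \<otimes>\<^bsub>generalized_dihedral A\<^esub> z)"
      using h k A unfolding xyz
      by (elim disjE) (simp_all add: generalized_dihedral_def semidirect_product_def
          inversion_action_def m_assoc inv_mult mod_simps)
    show "x \<otimes>\<^bsub>generalized_dihedral A\<^esub> y \<in> carrier (generalized_dihedral A)"
      using h k A unfolding xyz carrier_generalized_dihedral
      by (elim disjE) (simp_all add: generalized_dihedral_def semidirect_product_def
          inversion_action_def)
  next
    show "\<one>\<^bsub>generalized_dihedral A\<^esub> \<in> carrier (generalized_dihedral A)"
      by (simp add: carrier_generalized_dihedral, simp add: generalized_dihedral_def semidirect_product_def)
  next
    fix x assume "x \<in> carrier (generalized_dihedral A)"
    then show "\<one>\<^bsub>generalized_dihedral A\<^esub> \<otimes>\<^bsub>generalized_dihedral A\<^esub> x = x"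
      by (auto simp: carrier_generalized_dihedral)
        (simp_all add: generalized_dihedral_def semidirect_product_def inversion_action_def)
  qed
qed

lemma generalized_dihedral_conj:
  assumes "comm_group A" "a \<in> carrier A"
  shows "(\<one>\<^bsub>A\<^esub>, 1) \<otimes>\<^bsub>generalized_dihedral A\<^esub> (a, 0) \<otimes>\<^bsub>generalized_dihedral A\<^esub>
           inv\<^bsub>generalized_dihedral A\<^esub> (\<one>\<^bsub>A\<^esub>, 1) = (inv\<^bsub>A\<^esub> a, 0)"
proof -
  interpret comm_group A by fact
  have "inv\<^bsub>generalized_dihedral A\<^esub> (\<one>\<^bsub>A\<^esub>, 1) = (\<one>\<^bsub>A\<^esub>, 1)"
    by (rule group.inv_equality[OF group_generalized_dihedral[OF assms(1)]])
      (auto simp: carrier_generalized_dihedral,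
       auto simp: generalized_dihedral_def semidirect_product_def inversion_action_def)
  then show ?thesis
    using assms(2) by (simp add: generalized_dihedral_def semidirect_product_def inversion_action_def)
qed

end

theory Submission
  imports Defs
begin

text \<open>
  Let \<open>n = |A|\<close>, so \<open>|G| = 2n\<close>, and let \<open>S\<close> have \<open>3n\<close> terms: the rotations
  \<open>(a, 0)\<close>, recorded as a multiset \<open>X\<close> over \<open>A\<close>, and the reflections \<open>(b, 1)\<close>, recorded as a
  multiset \<open>Y\<close>.  Every reflection inverts what stands to its right.  Hence, once reflections are
  present, terms of \<open>S\<close> can be ordered to have product one as soon as the reflections used fall
  into two halves, and the rotations used into two classes, such that the products of both sides
  agree in \<open>A\<close> (lemma \<open>balanced_imp_product_one\<close>).  The two classes of rotations are arbitrary,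
  so two equal rotations, or two equal reflections, can always be thrown in for free.

  The proof selects a pair of reflections \<open>y0, y\<close>, compensates \<open>y / y0\<close> by few rotations and fills
  this up to \<open>2n\<close> terms with cancelling pieces.

  Compensation (\<open>full_or_shifted\<close>).  If two equal reflections occur, nothing is needed.  Otherwise the
  \<open>w = |Y|\<close> reflections are distinct, so \<open>X\<close> has \<open>3n - w\<close> terms.  Let \<open>g\<close> be
  the most frequent one, with multiplicity \<open>h\<close>, and divide all rotations by \<open>g\<close>.  Take from the terms
  other than \<open>g\<close> a largest product-one part \<open>T\<close> of at most \<open>2n\<close> quotients.  If \<open>T\<close> has at least
  \<open>2n - h\<close> terms, copies of \<open>g\<close> complete it to \<open>2n\<close> rotations with product \<open>g ^ (2n) = 1\<close>.
  Otherwise more than \<open>n - w\<close> quotients remain, and by maximality no nonempty part of at most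
  \<open>h\<close> of them has product one.  By the theorem of Scherk (lemma \<open>scherk\<close>), \<open>n - w + 1\<close> of these
  quotients already have at least \<open>n - w + 2\<close> subproducts of at most \<open>h\<close> factors
  (\<open>card_short_subproducts\<close>).  The \<open>w\<close> quotients \<open>y / y0\<close> for a fixed \<open>y0\<close> therefore share at
  least two elements with them, and one of these is not the identity.  This represents some
  \<open>y / y0\<close> with \<open>y \<noteq> y0\<close> by few terms of \<open>X\<close> against equally many copies of \<open>g\<close>.  (For \<open>w \<le> 1\<close>
  two common elements are impossible, so \<open>2n\<close> rotations with product one exist.)

  Filling (\<open>balanced_exists\<close>).  Any \<open>n + 2k\<close> further terms contain \<open>2k\<close> terms that cancel, except
  for a parity defect of two terms.  Equal pairs are used while there are any.  When none are
  left, rotations and reflections form two sets with more than \<open>n + 1\<close> elements in total, so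
  \<open>x y = x' y'\<close> has a nontrivial solution, which gives four cancelling terms.  One additional
  equal pair repairs the defect, and \<open>full_or_balanced\<close> shows that it can always be provided.
\<close>

section \<open>Products of multisets in an abelian group\<close>

text \<open>The product is taken over the support with powers as multiplicities, so that it is
  independent of an ordering of the terms by construction.\<close>

definition mprod :: "('a, 'b) monoid_scheme \<Rightarrow> 'a multiset \<Rightarrow> 'a" where
  "mprod G M = (\<Otimes>\<^bsub>G\<^esub>x\<in>set_mset M. x [^]\<^bsub>G\<^esub> count M x)"

context comm_group
begin

lemma mprod_empty [simp]: "mprod G {#} = \<one>"
  by (simp add: mprod_def)

lemma mprod_closed [simp]: "set_mset M \<subseteq> carrier G \<Longrightarrow> mprod G M \<in> carrier G"
  unfolding mprod_def by (rule finprod_closed) auto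

lemma mprod_union:
  assumes "set_mset M \<subseteq> carrier G" "set_mset N \<subseteq> carrier G"
  shows "mprod G (M + N) = mprod G M \<otimes> mprod G N"
proof -
  let ?U = "set_mset M \<union> set_mset N"
  have ext: "mprod G K = (\<Otimes>x\<in>?U. x [^] count K x)" if "set_mset K \<subseteq> ?U" for K
    unfolding mprod_def using that assms
    by (intro finprod_mono_neutral_cong_left) (auto simp: not_in_iff)
  have "mprod G (M + N) = (\<Otimes>x\<in>?U. x [^] count M x \<otimes> x [^] count N x)"
    unfolding ext[of "M + N", simplified] using assms
    by (intro finprod_cong') (auto simp: nat_pow_mult)
  also have "\<dots> = mprod G M \<otimes> mprod G N"
    unfolding ext[of M, simplified] ext[of N, simplified] using assms
    by (intro finprod_multf) auto
  finally show ?thesis .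
qed

lemma mprod_single [simp]: "x \<in> carrier G \<Longrightarrow> mprod G {#x#} = x"
  by (simp add: mprod_def)

lemma mprod_add_mset [simp]:
  "x \<in> carrier G \<Longrightarrow> set_mset M \<subseteq> carrier G \<Longrightarrow> mprod G (add_mset x M) = x \<otimes> mprod G M"
  using mprod_union[of "{#x#}" M] by simp

lemma mprod_replicate [simp]: "x \<in> carrier G \<Longrightarrow> mprod G (replicate_mset k x) = x [^] k"
  by (induction k) (auto simp: m_comm)

lemma mprod_translate:
  assumes "g \<in> carrier G" "set_mset M \<subseteq> carrier G"
  shows "mprod G {#x \<otimes> inv g. x \<in># M#} \<otimes> g [^] size M = mprod G M"
  using assms(2)
proof (induction M)
  case (add x M)
  then have M: "set_mset M \<subseteq> carrier G" and x: "x \<in> carrier G"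
    by auto
  let ?N = "{#x \<otimes> inv g. x \<in># M#}"
  have N: "set_mset ?N \<subseteq> carrier G"
    using M assms(1) by auto
  then have "mprod G {#x \<otimes> inv g. x \<in># add_mset x M#} \<otimes> g [^] size (add_mset x M)
      = (x \<otimes> inv g \<otimes> mprod G ?N) \<otimes> (g [^] size M \<otimes> g)"
    using x assms(1) by simp
  also have "\<dots> = x \<otimes> (inv g \<otimes> g) \<otimes> (mprod G ?N \<otimes> g [^] size M)"
    using x assms(1) mprod_closed[OF N] by (simp only: m_ac inv_closed m_closed nat_pow_closed)
  finally have "mprod G {#x \<otimes> inv g. x \<in># add_mset x M#} \<otimes> g [^] size (add_mset x M)
      = x \<otimes> (inv g \<otimes> g) \<otimes> (mprod G ?N \<otimes> g [^] size M)" .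
  then show ?case
    using x M assms(1) add.IH by simp
qed simp

section \<open>Sumsets and subset products\<close>

text \<open>Scherk's theorem, by an exchange that keeps the sum of the cardinalities: for \<open>e \<in> B\<close>, all
  \<open>x \<in> C\<close> with \<open>x e \<notin> B\<close> are removed from \<open>C\<close>, and the products \<open>x e\<close> are added to
  \<open>B\<close>.  The product set does not grow, and the identity keeps its unique representation.  A
  suitable \<open>e\<close> exists, since otherwise multiplication by some \<open>c \<in> C\<close>, \<open>c \<noteq> 1\<close>,
  would permute the finite set \<open>B\<close>, and the identity would have a second representation.\<close>

lemma scherk:
  assumes "finite B" "finite C" "B \<subseteq> carrier G" "C \<subseteq> carrier G" "\<one> \<in> B" "\<one> \<in> C"
    and "\<And>b c. b \<in> B \<Longrightarrow> c \<in> C \<Longrightarrow> b \<otimes> c = \<one> \<Longrightarrow> b = \<one> \<and> c = \<one>"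
  shows "card B + card C \<le> card (B <#> C) + 1"
  using assms
proof (induction "card C" arbitrary: B C rule: less_induct)
  case less
  note fin = less.prems(1,2) and sub = less.prems(3,4) and one = less.prems(5,6)
    and unique = less.prems(7)
  show ?case
  proof (cases "C = {\<one>}")
    case True
    then have "B <#> C = B"
      using sub by (force simp: set_mult_def)
    then show ?thesis
      using True by simp
  next
    case False
    then obtain c where c: "c \<in> C" "c \<noteq> \<one>"
      using one(2) by auto
    have fin_mult: "finite (B <#> C)"
      using fin by (simp add: set_mult_def)
    have "\<exists>e\<in>B. \<exists>d\<in>C. d \<otimes> e \<notin> B"
    proof (rule ccontr)
      assume "\<not> ?thesis"
      then have "(\<lambda>b. c \<otimes> b) ` B \<subseteq> B"
        using c by auto
      moreover have "inj_on (\<lambda>b. c \<otimes> b) B"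
        using c sub by (intro inj_on_subset[OF inj_on_cmult]) auto
      ultimately have "(\<lambda>b. c \<otimes> b) ` B = B"
        using fin(1) by (simp add: endo_inj_surj)
      then obtain b where "b \<in> B" "c \<otimes> b = \<one>"
        using one(1) by (metis imageE)
      then show False
        using unique[of b c] c sub by (metis m_comm subsetD)
    qed
    then obtain e d where e: "e \<in> B" and d: "d \<in> C" "d \<otimes> e \<notin> B"
      by blast
    have e': "e \<in> carrier G"
      using e sub by auto
    define C' where "C' = {x \<in> C. x \<otimes> e \<in> B}"
    define B' where "B' = B \<union> (\<lambda>x. x \<otimes> e) ` (C - C')"
    have sub': "B' \<subseteq> carrier G" "C' \<subseteq> carrier G"
      using sub e' by (auto simp: B'_def C'_def)
    have fin': "finite B'" "finite C'"
      using fin by (auto simp: B'_def C'_def)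
    have "card C' < card C"
      using d fin by (intro psubset_card_mono) (auto simp: C'_def)
    moreover have "\<one> \<in> B'" "\<one> \<in> C'"
      using one e e' by (auto simp: B'_def C'_def)
    moreover have "b = \<one> \<and> x = \<one>" if b: "b \<in> B'" and x: "x \<in> C'" and bx: "b \<otimes> x = \<one>" for b x
    proof (cases "b \<in> B")
      case True
      then show ?thesis
        using unique[of b x] x bx by (auto simp: C'_def)
    next
      case False
      then obtain y where y: "y \<in> C" "b = y \<otimes> e"
        using b by (auto simp: B'_def)
      have xe: "x \<in> C" "x \<otimes> e \<in> B"
        using x by (auto simp: C'_def)
      have carr: "x \<in> carrier G" "y \<in> carrier G"
        using xe y sub by auto
      have "(x \<otimes> e) \<otimes> y = \<one>"
        using bx y carr e' by (simp add: m_ac)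
      then have "x \<otimes> e = \<one>" "y = \<one>"
        using unique[of "x \<otimes> e" y] xe y by auto
      then show ?thesis
        using False y e e' by simp
    qed
    ultimately have "card B' + card C' \<le> card (B' <#> C') + 1"
      using less.hyps[of C' B'] fin' sub' by blast
    moreover have "B' <#> C' \<subseteq> B <#> C"
    proof
      fix z assume "z \<in> B' <#> C'"
      then obtain b x where z: "z = b \<otimes> x" "b \<in> B'" "x \<in> C'"
        by (auto simp: set_mult_def)
      have x: "x \<in> C" "x \<otimes> e \<in> B" "x \<in> carrier G"
        using z(3) sub by (auto simp: C'_def)
      show "z \<in> B <#> C"
      proof (cases "b \<in> B")
        case True
        then show ?thesis
          using z x by (auto simp: set_mult_def)
      next
        case False
        then obtain y where y: "y \<in> C" "b = y \<otimes> e"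
          using z(2) by (auto simp: B'_def)
        then have "z = (x \<otimes> e) \<otimes> y"
          using z(1) x e' sub by (auto simp: m_ac)
        then show ?thesis
          using x y by (auto simp: set_mult_def)
      qed
    qed
    then have "card (B' <#> C') \<le> card (B <#> C)"
      using fin_mult by (rule card_mono[rotated])
    moreover have "card B' = card B + (card C - card C')"
    proof -
      have "B \<inter> (\<lambda>x. x \<otimes> e) ` (C - C') = {}"
        by (auto simp: C'_def)
      moreover have "inj_on (\<lambda>x. x \<otimes> e) (C - C')"
        using e' sub by (intro inj_on_subset[OF inj_on_multc]) auto
      moreover have "C' \<subseteq> C"
        by (auto simp: C'_def)
      ultimately show ?thesis
        using fin fin' by (simp add: B'_def card_Un_disjoint card_image card_Diff_subset)
    qed
    ultimately show ?thesis
      using \<open>card C' < card C\<close> by linarith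
  qed
qed

definition short_subproducts :: "nat \<Rightarrow> 'a multiset \<Rightarrow> 'a set" where
  "short_subproducts h Z = {mprod G U | U. U \<subseteq># Z \<and> size U \<le> h}"

lemma short_subproducts_closed:
  "set_mset Z \<subseteq> carrier G \<Longrightarrow> short_subproducts h Z \<subseteq> carrier G"
  unfolding short_subproducts_def using mprod_closed set_mset_mono by blast

text \<open>The bound on multiplicities allows \<open>Z\<close> to be cut into \<open>h\<close> sets.  Choosing at most one element
  from each set gives subproducts of at most \<open>h\<close> factors, and Scherk's theorem applies each time a
  set is added, because a second representation of the identity would be a short product-one part
  of \<open>Z\<close>.  The induction peels off the support of \<open>Z\<close>, which lowers every multiplicity by one.\<close>

lemma card_short_subproducts:
  assumes "finite (carrier G)" "set_mset Z \<subseteq> carrier G" "\<And>z. count Z z \<le> h"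
    and "\<And>U. U \<subseteq># Z \<Longrightarrow> U \<noteq> {#} \<Longrightarrow> size U \<le> h \<Longrightarrow> mprod G U \<noteq> \<one>"
  shows "size Z + 1 \<le> card (short_subproducts h Z)"
  using assms(2-)
proof (induction h arbitrary: Z)
  case 0
  then have "Z = {#}"
    by (intro multiset_eqI) simp
  then show ?case
    by (simp add: short_subproducts_def)
next
  case (Suc h)
  note carr = Suc.prems(1) and mult = Suc.prems(2) and free = Suc.prems(3)
  define W where "W = Z - mset_set (set_mset Z)"
  let ?B = "short_subproducts h W" and ?C = "insert \<one> (set_mset Z)"
  have Z: "Z = W + mset_set (set_mset Z)"
    unfolding W_def by (simp add: mset_set_set_mset_msubset)
  have W_sub: "W \<subseteq># Z"
    by (simp add: W_def)
  have carrW: "set_mset W \<subseteq> carrier G"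
    using carr set_mset_mono[OF W_sub] by auto
  have "count W z \<le> h" for z
    using mult[of z] by (cases "z \<in># Z") (auto simp: W_def not_in_iff)
  then have IH: "size W + 1 \<le> card ?B"
    using free W_sub carrW by (intro Suc.IH) (auto intro: subset_mset.order_trans)
  have U_add: "add_mset z U \<subseteq># Z" if "z \<in># Z" "U \<subseteq># W" for z U
  proof -
    have "U + {#z#} \<subseteq># W + mset_set (set_mset Z)"
      using that by (intro subset_mset.add_mono) auto
    then show ?thesis
      using Z by simp
  qed
  have carrU: "set_mset U \<subseteq> carrier G" if "U \<subseteq># W" for U
    using carrW set_mset_mono[OF that] by auto
  have one_notin: "\<one> \<notin># Z"
    using free[of "{#\<one>#}"] by auto
  have "card ?B + card ?C \<le> card (?B <#> ?C) + 1"
  proof (rule scherk)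
    show "finite ?B"
      using assms(1) short_subproducts_closed[OF carrW] by (rule finite_subset[rotated])
    show "\<one> \<in> ?B"
      unfolding short_subproducts_def by (auto intro!: exI[of _ "{#}"])
    show "b = \<one> \<and> c = \<one>" if b: "b \<in> ?B" and c: "c \<in> ?C" and bc: "b \<otimes> c = \<one>" for b c
    proof -
      obtain U where U: "b = mprod G U" "U \<subseteq># W" "size U \<le> h"
        using b by (auto simp: short_subproducts_def)
      have "c = \<one>"
      proof (rule ccontr)
        assume "c \<noteq> \<one>"
        then have c': "c \<in># Z"
          using c by simp
        have "mprod G (add_mset c U) = \<one>"
          using bc carrU[OF U(2)] c' carr U(1) by (simp add: m_comm subset_iff)
        then show False
          using free[OF U_add[OF c' U(2)]] U(3) by simp
      qed
      then show ?thesis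
        using bc U(1) carrU[OF U(2)] by simp
    qed
  qed (use carr short_subproducts_closed[OF carrW] in auto)
  moreover have "card ?C = size (mset_set (set_mset Z)) + 1"
    using one_notin by simp
  moreover have "size Z = size W + size (mset_set (set_mset Z))"
    using arg_cong[OF Z, of size] by simp
  moreover have "?B <#> ?C \<subseteq> short_subproducts (Suc h) Z"
  proof
    fix x assume "x \<in> ?B <#> ?C"
    then obtain U c where U: "x = mprod G U \<otimes> c" "U \<subseteq># W" "size U \<le> h" and c: "c \<in> ?C"
      by (auto simp: short_subproducts_def set_mult_def)
    show "x \<in> short_subproducts (Suc h) Z"
    proof (cases "c = \<one>")
      case True
      then have "x = mprod G U"
        using U carrU by simp
      moreover have "U \<subseteq># Z"
        using U(2) W_sub by (rule subset_mset.order_trans)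
      ultimately show ?thesis
        using U(3) by (auto simp: short_subproducts_def)
    next
      case False
      then have c': "c \<in># Z"
        using c by simp
      then have "x = mprod G (add_mset c U)"
        using U carrU carr by (simp add: m_comm subset_iff)
      then show ?thesis
        using U(3) U_add[OF c' U(2)] unfolding short_subproducts_def
        by (intro CollectI exI[of _ "add_mset c U"]) simp
    qed
  qed
  then have "card (?B <#> ?C) \<le> card (short_subproducts (Suc h) Z)"
    using finite_subset[OF short_subproducts_closed[OF carr] assms(1)]
    by (intro card_mono) auto
  ultimately show ?case
    using IH by linarith
qed


section \<open>Balanced parts\<close>

text \<open>The parts \<open>P, Q\<close> of the rotations \<open>X\<close> and the equally large parts \<open>R, T\<close> of the reflections
  \<open>Y\<close> are those terms that occur, in a suitable ordering, with exponent \<open>1\<close> and with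
  exponent \<open>- 1\<close>, respectively.  In total \<open>2 * m\<close> terms are used, and \<open>2 * l\<close> of them are reflections;
  the parameter \<open>l\<close> matters because an inverted rotation requires a reflection.\<close>

definition balanced :: "'a multiset \<Rightarrow> 'a multiset \<Rightarrow> nat \<Rightarrow> nat \<Rightarrow> bool" where
  "balanced X Y m l \<longleftrightarrow> (\<exists>P Q R T. P + Q \<subseteq># X \<and> R + T \<subseteq># Y \<and>
     size R = l \<and> size T = l \<and> size P + size Q + 2 * l = 2 * m \<and>
     mprod G P \<otimes> mprod G R = mprod G Q \<otimes> mprod G T)"

lemma balanced_empty: "balanced X Y 0 0"
  unfolding balanced_def by (intro exI[of _ "{#}"]) auto

lemma balanced_add:
  assumes "balanced X Y m l" "balanced X' Y' m' l'"
    and "set_mset (X + X') \<subseteq> carrier G" "set_mset (Y + Y') \<subseteq> carrier G"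
  shows "balanced (X + X') (Y + Y') (m + m') (l + l')"
proof -
  obtain P Q R T where 1: "P + Q \<subseteq># X" "R + T \<subseteq># Y" "size R = l" "size T = l"
      "size P + size Q + 2 * l = 2 * m" "mprod G P \<otimes> mprod G R = mprod G Q \<otimes> mprod G T"
    using assms(1) unfolding balanced_def by blast
  obtain P' Q' R' T' where 2: "P' + Q' \<subseteq># X'" "R' + T' \<subseteq># Y'" "size R' = l'" "size T' = l'"
      "size P' + size Q' + 2 * l' = 2 * m'" "mprod G P' \<otimes> mprod G R' = mprod G Q' \<otimes> mprod G T'"
    using assms(2) unfolding balanced_def by blast
  have carr: "set_mset P \<subseteq> carrier G" "set_mset Q \<subseteq> carrier G"
      "set_mset R \<subseteq> carrier G" "set_mset T \<subseteq> carrier G"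
      "set_mset P' \<subseteq> carrier G" "set_mset Q' \<subseteq> carrier G"
      "set_mset R' \<subseteq> carrier G" "set_mset T' \<subseteq> carrier G"
    using set_mset_mono[OF 1(1)] set_mset_mono[OF 1(2)] set_mset_mono[OF 2(1)]
      set_mset_mono[OF 2(2)] assms(3,4) by auto
  note [simp] = carr[THEN mprod_closed]
  have "mprod G (P + P') \<otimes> mprod G (R + R')
      = (mprod G P \<otimes> mprod G R) \<otimes> (mprod G P' \<otimes> mprod G R')"
    using carr by (simp add: mprod_union m_ac)
  also have "\<dots> = mprod G (Q + Q') \<otimes> mprod G (T + T')"
    unfolding 1(6) 2(6) using carr by (simp add: mprod_union m_ac)
  finally have prod: "mprod G (P + P') \<otimes> mprod G (R + R') = mprod G (Q + Q') \<otimes> mprod G (T + T')" .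
  have "P + P' + (Q + Q') \<subseteq># X + X'"
    using subset_mset.add_mono[OF 1(1) 2(1)] by (simp add: ac_simps)
  moreover have "R + R' + (T + T') \<subseteq># Y + Y'"
    using subset_mset.add_mono[OF 1(2) 2(2)] by (simp add: ac_simps)
  ultimately show ?thesis
    unfolding balanced_def using prod 1(3-5) 2(3-5)
    by (intro exI[of _ "P + P'"] exI[of _ "Q + Q'"] exI[of _ "R + R'"] exI[of _ "T + T'"]) auto
qed

lemma balanced_pair_left: "x \<in> carrier G \<Longrightarrow> balanced {#x, x#} {#} 1 0"
  unfolding balanced_def by (intro exI[of _ "{#x#}"] exI[of _ "{#}"]) auto

lemma balanced_pair_right: "y \<in> carrier G \<Longrightarrow> balanced {#} {#y, y#} 1 1"
  unfolding balanced_def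
  by (intro exI[of _ "{#}"] exI[of _ "{#y#}"] conjI) (auto intro: exI[of _ "{#y#}"])

lemma balanced_quadruple:
  assumes "x \<in> carrier G" "x' \<in> carrier G" "y \<in> carrier G" "y' \<in> carrier G"
    and "x \<otimes> y = x' \<otimes> y'"
  shows "balanced {#x, x'#} {#y, y'#} 2 1"
  unfolding balanced_def
  by (rule exI[of _ "{#x#}"], rule exI[of _ "{#x'#}"], rule exI[of _ "{#y#}"],
      rule exI[of _ "{#y'#}"]) (use assms in auto)

lemma repeated_term:
  assumes "\<not> (\<forall>x. count M x \<le> 1)"
  obtains x M' where "M = M' + {#x, x#}"
proof -
  obtain x where "2 \<le> count M x"
    using assms by (metis One_nat_def Suc_1 not_less_eq_eq)
  then have "replicate_mset 2 x \<subseteq># M"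
    by (simp add: count_le_replicate_mset_subset_eq)
  then have "{#x, x#} \<subseteq># M"
    by (simp add: numeral_2_eq_2)
  then show ?thesis
    using that by (metis subset_mset.diff_add)
qed

lemma size_distinct:
  assumes "\<forall>x. count M x \<le> 1"
  shows "size M = card (set_mset M)"
proof -
  have "M = mset_set (set_mset M)"
    using assms by (intro multiset_eqI) (metis count_mset_set(1,3) finite_set_mset le_antisym
        not_in_iff count_greater_eq_one_iff)
  then show ?thesis
    by (metis size_mset_set)
qed

text \<open>Both sets have at least two elements, hence more pairs than the group has elements, and two
  pairs have the same product.\<close>

lemma distinct_quadruple:
  assumes "finite (carrier G)" "set_mset X \<subseteq> carrier G" "set_mset Y \<subseteq> carrier G"
    and "\<forall>x. count X x \<le> 1" "\<forall>y. count Y y \<le> 1"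
    and "order G + 2 \<le> size X + size Y"
  obtains x x' y y' X' Y' where "X = X' + {#x, x'#}" "Y = Y' + {#y, y'#}" "x \<otimes> y = x' \<otimes> y'"
proof -
  let ?B = "set_mset X" and ?C = "set_mset Y"
  have card: "size X = card ?B" "size Y = card ?C"
    using assms(4,5) by (simp_all add: size_distinct)
  have "card ?B \<le> order G" "card ?C \<le> order G"
    unfolding order_def using assms(1-3) by (simp_all add: card_mono)
  then have "2 \<le> card ?B" "2 \<le> card ?C"
    using assms(6) card by auto
  then obtain b c where bc: "card ?B = b + 2" "card ?C = c + 2"
    by (metis add.commute le_iff_add)
  have "order G < card (?B \<times> ?C)"
    using assms(6) unfolding card card_cartesian_product bc by (simp add: algebra_simps)
  moreover have "card ((\<lambda>(x, y). x \<otimes> y) ` (?B \<times> ?C)) \<le> order G"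
    unfolding order_def using assms(1-3) by (intro card_mono) auto
  ultimately have "\<not> inj_on (\<lambda>(x, y). x \<otimes> y) (?B \<times> ?C)"
    by (intro pigeonhole) simp
  then obtain x y x' y' where q: "x \<in># X" "y \<in># Y" "x' \<in># X" "y' \<in># Y"
      "x \<otimes> y = x' \<otimes> y'" "(x, y) \<noteq> (x', y')"
    by (auto simp: inj_on_def)
  have carr: "x \<in> carrier G" "y \<in> carrier G" "x' \<in> carrier G" "y' \<in> carrier G"
    using q assms(2,3) by auto
  have "x \<noteq> x'" "y \<noteq> y'"
    using q(5,6) carr by auto
  then have "{#x, x'#} \<subseteq># X" "{#y, y'#} \<subseteq># Y"
    using q by (simp_all add: insert_subset_eq_iff in_diff_count)
  then show ?thesis
    using that q(5) by (metis subset_mset.diff_add)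
qed

text \<open>The defect in the second alternative cannot be avoided: if both multisets are sets, then
  equal pairs are missing and cancelling terms may be available only in groups of four, although
  \<open>k\<close> is odd.  Such a group contains reflections, which is recorded by \<open>l \<ge> 1\<close>.  Each step of the
  induction splits off a cancelling piece of \<open>2 * i\<close> terms.\<close>

lemma balanced_exists:
  assumes "finite (carrier G)" "set_mset X \<subseteq> carrier G" "set_mset Y \<subseteq> carrier G"
    and "order G + 2 * k \<le> size X + size Y"
  shows "(\<exists>l. balanced X Y k l) \<or> (\<exists>l\<ge>1. balanced X Y (k + 1) l)"
  using assms(2-)
proof (induction k arbitrary: X Y rule: less_induct)
  case (less k)
  note carr = less.prems(1,2) and len = less.prems(3)
  have combine: "(\<exists>l. balanced X Y k l) \<or> (\<exists>l\<ge>1. balanced X Y (k + 1) l)"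
    if hyp: "j + i = k" "0 < i" "X = X' + V" "Y = Y' + W" "balanced V W i s"
      "order G + 2 * j \<le> size X' + size Y'" for j i X' Y' V W s
  proof -
    have "set_mset X' \<subseteq> carrier G" "set_mset Y' \<subseteq> carrier G"
      using carr hyp by auto
    moreover have "j < k"
      using hyp(1,2) by simp
    ultimately have "(\<exists>l. balanced X' Y' j l) \<or> (\<exists>l\<ge>1. balanced X' Y' (j + 1) l)"
      using less.IH[of j X' Y'] hyp(6) by blast
    then consider l where "balanced X' Y' j l" | l where "1 \<le> l" "balanced X' Y' (j + 1) l"
      by blast
    then show ?thesis
    proof cases
      case 1
      then have "balanced X Y k (l + s)"
        using balanced_add[OF 1 hyp(5)] carr unfolding hyp(3,4) hyp(1) by simp
      then show ?thesis by blast
    next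
      case 2
      then have "balanced X Y (k + 1) (l + s)"
        using balanced_add[OF 2(2) hyp(5)] carr unfolding hyp(3,4) hyp(1)[symmetric]
        by (simp add: add.commute add.left_commute)
      then show ?thesis using 2(1) by (meson trans_le_add1)
    qed
  qed
  consider "k = 0" | "0 < k" "\<not> (\<forall>x. count X x \<le> 1)" | "0 < k" "\<not> (\<forall>y. count Y y \<le> 1)"
    | "0 < k" "\<forall>x. count X x \<le> 1" "\<forall>y. count Y y \<le> 1"
    by blast
  then show ?case
  proof cases
    case 1
    then show ?thesis
      using balanced_empty by blast
  next
    case 2
    obtain X' x where X: "X = X' + {#x, x#}"
      using 2(2) by (rule repeated_term)
    have x: "x \<in> carrier G"
      using carr(1) X by simp
    have len': "order G + 2 * (k - 1) \<le> size X' + size Y"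
      using len X 2(1) by simp
    show ?thesis
      by (rule combine[OF _ zero_less_one X _ balanced_pair_left[OF x] len']) (use 2(1) in simp_all)
  next
    case 3
    obtain Y' y where Y: "Y = Y' + {#y, y#}"
      using 3(2) by (rule repeated_term)
    have y: "y \<in> carrier G"
      using carr(2) Y by simp
    have len': "order G + 2 * (k - 1) \<le> size X + size Y'"
      using len Y 3(1) by simp
    show ?thesis
      by (rule combine[OF _ zero_less_one _ Y balanced_pair_right[OF y] len']) (use 3(1) in simp_all)
  next
    case 4
    have "order G + 2 \<le> size X + size Y"
      using len 4(1) by simp
    then obtain x x' y y' X' Y' where q: "X = X' + {#x, x'#}" "Y = Y' + {#y, y'#}"
        "x \<otimes> y = x' \<otimes> y'"
      by (rule distinct_quadruple[OF assms(1) carr 4(2,3)])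
    have quad: "balanced {#x, x'#} {#y, y'#} 2 1"
      using balanced_quadruple q carr by simp
    show ?thesis
    proof (cases "k = 1")
      case True
      then have "balanced X Y (k + 1) 1"
        using balanced_add[OF balanced_empty[of X' Y'] quad] carr q(1,2) by simp
      then show ?thesis by blast
    next
      case False
      have len': "order G + 2 * (k - 2) \<le> size X' + size Y'"
        using len q(1,2) False 4(1) by simp
      show ?thesis
        by (rule combine[OF _ zero_less_numeral q(1,2) quad len']) (use False 4(1) in simp)
    qed
  qed
qed


section \<open>Compensating a pair of reflections\<close>

lemma ex_subset_mset_size: "k \<le> size M \<Longrightarrow> \<exists>N. N \<subseteq># M \<and> size N = k"
proof (induction k)
  case (Suc k)
  then obtain N where N: "N \<subseteq># M" "size N = k"
    by auto
  then have "M - N \<noteq> {#}"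
    using Suc.prems size_Diff_submset[OF N(1)] by auto
  then obtain x where "x \<in># M - N"
    by blast
  then have "add_mset x N \<subseteq># M"
    using N(1) by (metis add_mset_add_single mset_subset_eq_mono_add_left_cancel
        mset_subset_eq_single subset_mset.add_diff_inverse)
  then show ?case
    using N(2) by (metis size_add_mset)
qed (auto intro: exI[of _ "{#}"])

text \<open>The set \<open>D\<close> stands for the quotients of distinct reflections by a fixed one.  Its size enters
  through the inequality \<open>|C| + |D| \<ge> n + 2\<close> for the set \<open>C\<close> of short subproducts, which
  forces two common elements.  The bound on the size of \<open>U\<close> is essential later: it ensures
  that enough rotations remain for one of them to be repeated.\<close>

lemma full_or_shifted:
  assumes fin: "finite (carrier G)" and X: "set_mset X \<subseteq> carrier G" and D: "D \<subseteq> carrier G"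
    and len: "size X + card D = 3 * order G"
  shows "(\<exists>T. T \<subseteq># X \<and> size T = 2 * order G \<and> mprod G T = \<one>) \<or>
    (\<exists>g\<in>carrier G. \<exists>U. \<exists>d\<in>D. U + replicate_mset (size U) g \<subseteq># X \<and> size U + card D \<le> order G + 1 \<and>
      d \<noteq> \<one> \<and> mprod G U = d \<otimes> g [^] size U)" (is "?full \<or> ?shifted")
proof -
  let ?n = "order G"
  have pos: "0 < ?n"
    using fin one_closed by (auto simp: order_def card_gt_0_iff)
  have D_le: "card D \<le> ?n"
    using fin D by (simp add: order_def card_mono)
  then have "X \<noteq> {#}"
    using len pos by auto
  define h where "h = Max (count X ` set_mset X)"
  have "h \<in> count X ` set_mset X"
    unfolding h_def using \<open>X \<noteq> {#}\<close> by (intro Max_in) auto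
  then obtain g where g: "g \<in># X" "count X g = h"
    by auto
  have mult: "count X x \<le> h" for x
    by (cases "x \<in># X") (auto simp: h_def not_in_iff)
  have g': "g \<in> carrier G"
    using g X by auto
  define X1 where "X1 = X - replicate_mset h g"
  have gX: "replicate_mset h g \<subseteq># X"
    using g by (simp add: count_le_replicate_mset_subset_eq[symmetric])
  have X_eq: "X = X1 + replicate_mset h g"
    unfolding X1_def using gX by simp
  have carr: "set_mset U \<subseteq> carrier G" if "U \<subseteq># X1" for U
    using set_mset_mono[OF that] X unfolding X_eq by auto
  \<comment> \<open>After division by \<open>g\<close>, these are the product-one parts; a full set of \<open>2n\<close> terms is reached
    as soon as one of them leaves room for at most \<open>h\<close> copies of \<open>g\<close>.\<close>
  define good where "good T \<longleftrightarrow> T \<subseteq># X1 \<and> size T \<le> 2 * ?n \<and> mprod G T = g [^] size T" for T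
  have "good {#}"
    by (simp add: good_def)
  moreover have "\<forall>T. good T \<longrightarrow> size T < 2 * ?n + 1"
    by (simp add: good_def)
  ultimately obtain T where T: "good T" and maximal: "\<And>T'. good T' \<Longrightarrow> size T' \<le> size T"
    using ex_has_greatest_nat[of good "{#}" size "2 * ?n + 1"] by blast
  have T': "T \<subseteq># X1" "size T \<le> 2 * ?n" "mprod G T = g [^] size T"
    using T by (auto simp: good_def)
  show ?thesis
  proof (cases "2 * ?n \<le> size T + h")
    case True
    let ?F = "T + replicate_mset (2 * ?n - size T) g"
    have "replicate_mset (2 * ?n - size T) g \<subseteq># replicate_mset h g"
      using True by (simp add: count_le_replicate_mset_subset_eq[symmetric])
    then have "?F \<subseteq># X"
      unfolding X_eq using T'(1) by (intro subset_mset.add_mono)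
    moreover have "size ?F = 2 * ?n"
      using T'(2) by simp
    moreover have "mprod G ?F = g [^] (2 * ?n)"
      using T' carr[OF T'(1)] g' by (simp add: mprod_union nat_pow_mult)
    then have "mprod G ?F = \<one>"
      using g' pow_order_eq_1[OF g'] by (simp add: nat_pow_pow[symmetric] mult.commute)
    ultimately show ?thesis
      by blast
  next
    case False
    have "?n + 1 - card D \<le> size (X1 - T)"
      using False len T'(1) D_le arg_cong[OF X_eq, of size] by (simp add: size_Diff_submset)
    \<comment> \<open>Only part of the remaining terms is used, which keeps \<open>U\<close> short.\<close>
    then obtain V where V: "V \<subseteq># X1 - T" "size V = ?n + 1 - card D"
      using ex_subset_mset_size by blast
    have TV: "T + U \<subseteq># X1" if "U \<subseteq># V" for U
      using that V(1) T'(1) by (metis mset_subset_eq_mono_add_left_cancel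
          subset_mset.add_diff_inverse subset_mset.order_trans)
    have V_sub: "U \<subseteq># X1" if "U \<subseteq># V" for U
      using TV[OF that] by (metis mset_subset_eq_add_right subset_mset.order_trans)
    define Z where "Z = {#x \<otimes> inv g. x \<in># V#}"
    have lift: "\<exists>U'. U' \<subseteq># V \<and> size U' = size U \<and> mprod G U' = mprod G U \<otimes> g [^] size U"
      if U: "U \<subseteq># Z" for U
    proof -
      obtain U' K where U': "V = U' + K" "U = {#x \<otimes> inv g. x \<in># U'#}"
        using image_mset_eq_plusD[of "\<lambda>x. x \<otimes> inv g" V U "Z - U"]
          subset_mset.add_diff_inverse[OF U] unfolding Z_def by metis
      then have "U' \<subseteq># V"
        by simp
      with U'(2) show ?thesis
        using mprod_translate[OF g' carr[OF V_sub[of U']]] by auto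
    qed
    have carrZ: "set_mset Z \<subseteq> carrier G"
      using carr[OF V_sub] g' by (auto simp: Z_def)
    let ?C = "short_subproducts h Z"
    have "size Z + 1 \<le> card ?C"
    proof (rule card_short_subproducts[OF fin carrZ])
      fix z
      have "{x. x \<in># V \<and> z = x \<otimes> inv g} \<subseteq> {z \<otimes> g}"
        using carr[OF V_sub[OF subset_mset.order_refl]] g' by (auto simp: m_assoc subset_iff)
      then have "count Z z \<le> (\<Sum>x\<in>{z \<otimes> g}. count V x)"
        unfolding Z_def count_image_mset' by (intro sum_mono2) auto
      also have "\<dots> \<le> count X (z \<otimes> g)"
        using V_sub[of V] unfolding X_eq by (simp add: mset_subset_eq_count trans_le_add1)
      finally show "count Z z \<le> h"
        using mult le_trans by blast
    next
      fix U assume U: "U \<subseteq># Z" "U \<noteq> {#}" "size U \<le> h"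
      show "mprod G U \<noteq> \<one>"
      proof
        assume "mprod G U = \<one>"
        then obtain U' where U': "U' \<subseteq># V" "size U' = size U" "mprod G U' = g [^] size U'"
          using lift[OF U(1)] g' by auto
        have "mprod G (T + U') = g [^] size (T + U')"
          using U' T' carr[OF T'(1)] carr[OF V_sub[OF U'(1)]] g'
          by (simp add: mprod_union nat_pow_mult)
        then have "good (T + U')"
          using TV[OF U'(1)] U(3) U'(2) False by (simp add: good_def)
        then show False
          using maximal[of "T + U'"] U(2) U'(2) by simp
      qed
    qed
    moreover have C_sub: "?C \<subseteq> carrier G"
      using short_subproducts_closed[OF carrZ] .
    moreover have "card (?C \<union> D) \<le> ?n"
      unfolding order_def using fin C_sub D by (intro card_mono) auto
    moreover have "card ?C + card D = card (?C \<union> D) + card (?C \<inter> D)"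
      using finite_subset[OF C_sub fin] finite_subset[OF D fin] by (rule card_Un_Int)
    ultimately have "2 \<le> card (?C \<inter> D)"
      using V(2) D_le by (simp add: Z_def)
    then have "\<not> ?C \<inter> D \<subseteq> {\<one>}"
      using card_mono[of "{\<one>}" "?C \<inter> D"] by auto
    then obtain d where d: "d \<in> ?C" "d \<in> D" "d \<noteq> \<one>"
      by blast
    then obtain U where U: "U \<subseteq># Z" "size U \<le> h" "d = mprod G U"
      by (auto simp: short_subproducts_def)
    obtain U' where U': "U' \<subseteq># V" "size U' = size U" "mprod G U' = d \<otimes> g [^] size U'"
      using lift[OF U(1)] U(3) by auto
    have "replicate_mset (size U') g \<subseteq># replicate_mset h g"
      using U(2) U'(2) by (simp add: count_le_replicate_mset_subset_eq[symmetric])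
    then have "U' + replicate_mset (size U') g \<subseteq># X"
      unfolding X_eq using V_sub[OF U'(1)] by (intro subset_mset.add_mono)
    moreover have "size U' + card D \<le> ?n + 1"
      using size_mset_mono[OF U'(1)] V(2) D_le by simp
    ultimately show ?thesis
      using g' d(2,3) U'(3) by blast
  qed
qed

text \<open>The parity defect of \<open>balanced_exists\<close> is repaired with an equal pair that was set aside: two
  equal reflections if there are any, and otherwise two equal rotations.  In the second case
  \<open>X\<close> loses \<open>2 * size U\<close> terms, with \<open>size U \<le> n + 1 - w\<close> and \<open>w = size Y\<close>.  If more than these
  terms and \<open>y0, y\<close> is required, then more than \<open>n\<close> rotations are left and one value is
  repeated.  The alternative without reflections in the conclusion needs all rotations with
  exponent \<open>1\<close>, since nothing could invert them.\<close>

lemma full_or_balanced: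
  assumes fin: "finite (carrier G)" and X: "set_mset X \<subseteq> carrier G" and Y: "set_mset Y \<subseteq> carrier G"
    and len: "size X + size Y = 3 * order G"
  shows "(\<exists>T. T \<subseteq># X \<and> size T = 2 * order G \<and> mprod G T = \<one>) \<or>
    (\<exists>l\<ge>1. balanced X Y (order G) l)"
proof -
  let ?n = "order G"
  have pos: "0 < ?n"
    using fin one_closed by (auto simp: order_def card_gt_0_iff)
  show ?thesis
  proof (cases "\<forall>y. count Y y \<le> 1")
    case False
    then obtain Y' y where Y': "Y = Y' + {#y, y#}"
      by (rule repeated_term)
    have carr: "set_mset Y' \<subseteq> carrier G" "y \<in> carrier G"
      using Y Y' by auto
    have "?n + 2 * (?n - 1) \<le> size X + size Y'"
      using len pos Y' by simp
    from balanced_exists[OF fin X carr(1) this]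
    consider l where "balanced X Y' (?n - 1) l" | l where "1 \<le> l" "balanced X Y' ?n l"
      using pos by auto
    then show ?thesis
    proof cases
      case 1
      then have "balanced X Y ?n (l + 1)"
        using balanced_add[OF 1 balanced_pair_right[OF carr(2)]] X Y Y' pos by simp
      then show ?thesis
        by (metis le_add2)
    next
      case 2
      then have "balanced X Y ?n l"
        using balanced_add[OF 2(2) balanced_empty[of "{#}" "{#y, y#}"]] X Y Y' by simp
      then show ?thesis
        using 2(1) by blast
    qed
  next
    case distinct: True
    \<comment> \<open>The value is arbitrary if \<open>Y\<close> is empty; then \<open>D\<close> is empty as well.\<close>
    define y0 where "y0 = (SOME y. y \<in># Y)"
    have y0: "y0 \<in># Y" if "y \<in># Y" for y
      unfolding y0_def using that by (rule someI)
    define D where "D = (\<lambda>y. y \<otimes> inv y0) ` set_mset Y"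
    have D: "D \<subseteq> carrier G"
      using Y y0 by (auto simp: D_def)
    have "inj_on (\<lambda>y. y \<otimes> inv y0) (set_mset Y)"
    proof (cases "Y = {#}")
      case False
      then have "y0 \<in> carrier G"
        using Y y0 by blast
      then show ?thesis
        using Y by (intro inj_on_subset[OF inj_on_multc]) auto
    qed simp
    then have card_D: "card D = size Y"
      unfolding D_def by (simp add: card_image size_distinct[OF distinct])
    from full_or_shifted[OF fin X D] len card_D
    consider "\<exists>T. T \<subseteq># X \<and> size T = 2 * ?n \<and> mprod G T = \<one>"
      | g U d where "g \<in> carrier G" "d \<in> D" "U + replicate_mset (size U) g \<subseteq># X"
          "size U + size Y \<le> ?n + 1" "d \<noteq> \<one>" "mprod G U = d \<otimes> g [^] size U"
      by auto
    then show ?thesis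
    proof cases
      case 1
      then show ?thesis by blast
    next
      case 2
      note g = 2(1) and U_sub = 2(3) and U_len = 2(4) and U_prod = 2(6)
      obtain y where y: "y \<in># Y" "d = y \<otimes> inv y0"
        using 2(2) by (auto simp: D_def)
      have carr_y: "y \<in> carrier G" "y0 \<in> carrier G" "y0 \<in># Y"
        using y(1) y0 Y by auto
      have "y \<noteq> y0"
        using y(2) 2(5) carr_y by auto
      then have "{#y0, y#} \<subseteq># Y"
        using y(1) carr_y(3) by (simp add: insert_subset_eq_iff in_diff_count)
      then obtain Y' where Y': "Y = Y' + {#y0, y#}"
        by (metis subset_mset.diff_add)
      obtain X' where X': "X = X' + (U + replicate_mset (size U) g)"
        using U_sub by (metis subset_mset.diff_add)
      have carr: "set_mset X' \<subseteq> carrier G" "set_mset Y' \<subseteq> carrier G" "set_mset U \<subseteq> carrier G"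
        using X Y X' Y' by auto
      have "d \<otimes> g [^] size U \<otimes> y0 = g [^] size U \<otimes> y"
      proof -
        have "d \<otimes> g [^] size U \<otimes> y0 = (inv y0 \<otimes> y0) \<otimes> (g [^] size U \<otimes> y)"
          unfolding y(2) using carr_y g by (simp only: m_ac inv_closed m_closed nat_pow_closed)
        then show ?thesis
          using carr_y g by simp
      qed
      then have base: "balanced (U + replicate_mset (size U) g) {#y0, y#} (size U + 1) 1"
        unfolding balanced_def using carr_y g U_prod
        by (intro exI[of _ U] exI[of _ "replicate_mset (size U) g"] exI[of _ "{#y0#}"]
            exI[of _ "{#y#}"]) auto
      have extend: "\<exists>l\<ge>1. balanced X Y ?n l" if "balanced X' Y' (?n - 1 - size U) l" for l
      proof -
        have "balanced X Y (?n - 1 - size U + (size U + 1)) (l + 1)"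
          using balanced_add[OF that base] X Y unfolding X' Y' by simp
        moreover have "?n - 1 - size U + (size U + 1) = ?n"
          using U_len Y' by simp
        ultimately show ?thesis
          by (metis le_add2)
      qed
      show ?thesis
      proof (cases "?n - 1 - size U = 0")
        case True
        then show ?thesis
          using extend[of 0] balanced_empty by simp
      next
        case False
        define k where "k = ?n - 2 - size U"
        have k: "?n - 1 - size U = k + 1"
          using False by (simp add: k_def)
        have len': "size X' + size Y' = ?n + 2 * (k + 1)"
          using len X' Y' k by simp
        have "?n < size X'"
          using len' U_len Y' k by simp
        moreover have "card (set_mset X') \<le> ?n"
          unfolding order_def using carr(1) fin by (rule card_mono[rotated])
        ultimately have "\<not> (\<forall>x. count X' x \<le> 1)"
          using size_distinct[of X'] by auto
        then obtain X'' x where X'': "X' = X'' + {#x, x#}"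
          by (rule repeated_term)
        have carr': "set_mset X'' \<subseteq> carrier G" "x \<in> carrier G"
          using carr X'' by auto
        have "?n + 2 * k \<le> size X'' + size Y'"
          using len' X'' by simp
        from balanced_exists[OF fin carr'(1) carr(2) this]
        consider l where "balanced X'' Y' k l" | l where "balanced X'' Y' (k + 1) l"
          by blast
        then have "\<exists>l. balanced X' Y' (k + 1) l"
        proof cases
          case 1
          then show ?thesis
            using balanced_add[OF 1 balanced_pair_left[OF carr'(2)]] carr X'' by auto
        next
          case 2
          then show ?thesis
            using balanced_add[OF 2 balanced_empty[of "{#x, x#}" "{#}"]] carr X'' by auto
        qed
        then show ?thesis
          using extend k by auto
      qed
    qed
  qed
qed

end

section \<open>Products in the generalized dihedral group\<close>

lemma (in group) foldr_mult_closed: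
  "set xs \<subseteq> carrier G \<Longrightarrow> foldr (\<otimes>) xs \<one> \<in> carrier G"
  by (induction xs) auto

lemma (in group) foldr_mult_append:
  "set xs \<subseteq> carrier G \<Longrightarrow> set ys \<subseteq> carrier G \<Longrightarrow>
    foldr (\<otimes>) (xs @ ys) \<one> = foldr (\<otimes>) xs \<one> \<otimes> foldr (\<otimes>) ys \<one>"
  by (induction xs) (auto simp: m_assoc foldr_mult_closed)

lemma (in group) seq_products_mult:
  assumes "s \<in> seq_products G S" "t \<in> seq_products G T" "seq_over G S" "seq_over G T"
  shows "s \<otimes> t \<in> seq_products G (S + T)"
proof -
  obtain xs ys where "s = foldr (\<otimes>) xs \<one>" "mset xs = S" "t = foldr (\<otimes>) ys \<one>" "mset ys = T"
    using assms(1,2) by (auto simp: seq_products_def)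
  then show ?thesis
    using assms(3,4) unfolding seq_products_def seq_over_def
    by (intro CollectI exI[of _ "xs @ ys"]) (auto simp: foldr_mult_append simp del: foldr_append)
qed

lemma (in group) seq_products_single: "g \<in> carrier G \<Longrightarrow> g \<in> seq_products G {#g#}"
  unfolding seq_products_def by (intro CollectI exI[of _ "[g]"]) simp

abbreviation rotation :: "'a \<Rightarrow> 'a \<times> int" where
  "rotation a \<equiv> (a, 0)"

abbreviation reflection :: "'a \<Rightarrow> 'a \<times> int" where
  "reflection a \<equiv> (a, 1)"

context comm_group
begin

lemma dihedral_mult:
  "rotation a \<otimes>\<^bsub>generalized_dihedral G\<^esub> (b, h) = (a \<otimes> b, h mod 2)"
  "reflection a \<otimes>\<^bsub>generalized_dihedral G\<^esub> (b, h) = (a \<otimes> inv b, (1 + h) mod 2)"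
  by (simp_all add: generalized_dihedral_def semidirect_product_def inversion_action_def
      integer_mod_group_def)

lemma dihedral_one: "\<one>\<^bsub>generalized_dihedral G\<^esub> = rotation \<one>"
  by (simp add: generalized_dihedral_def semidirect_product_def)

lemma seq_over_dihedral:
  "set_mset X \<subseteq> carrier G \<Longrightarrow> seq_over (generalized_dihedral G) (image_mset rotation X)"
  "set_mset X \<subseteq> carrier G \<Longrightarrow> seq_over (generalized_dihedral G) (image_mset reflection X)"
  by (auto simp: seq_over_def carrier_generalized_dihedral)

lemma seq_over_union: "seq_over H (S + T) \<longleftrightarrow> seq_over H S \<and> seq_over H T"
  by (auto simp: seq_over_def)

lemmas dihedral_products =
  group.seq_products_mult[OF group_generalized_dihedral[OF comm_group_axioms]]
  group.seq_products_single[OF group_generalized_dihedral[OF comm_group_axioms]]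

lemma rotation_products:
  assumes "set_mset X \<subseteq> carrier G"
  shows "rotation (mprod G X) \<in> seq_products (generalized_dihedral G) (image_mset rotation X)"
  using assms
proof (induction X)
  case empty
  then show ?case
    by (simp add: seq_products_def dihedral_one)
next
  case (add x X)
  then have "rotation x \<otimes>\<^bsub>generalized_dihedral G\<^esub> rotation (mprod G X)
      \<in> seq_products (generalized_dihedral G) ({#rotation x#} + image_mset rotation X)"
    by (intro dihedral_products seq_over_dihedral)
      (auto simp: seq_over_def carrier_generalized_dihedral)
  then show ?case
    using add.prems by (simp add: dihedral_mult)
qed

text \<open>Reflections from \<open>R\<close> and \<open>T\<close> are taken in turn; a product of two reflections is the rotation
  by their quotient.\<close>

lemma reflection_products:
  assumes "size R = size T" "set_mset R \<subseteq> carrier G" "set_mset T \<subseteq> carrier G"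
  shows "rotation (mprod G R \<otimes> inv (mprod G T))
    \<in> seq_products (generalized_dihedral G) (image_mset reflection (R + T))"
  using assms
proof (induction R arbitrary: T)
  case empty
  then show ?case
    by (simp add: seq_products_def dihedral_one)
next
  case (add x R)
  then obtain y T' where T: "T = add_mset y T'"
    by (metis size_eq_Suc_imp_eq_union size_add_mset)
  have carr: "x \<in> carrier G" "y \<in> carrier G" "set_mset R \<subseteq> carrier G" "set_mset T' \<subseteq> carrier G"
    using add.prems T by auto
  have "reflection x \<otimes>\<^bsub>generalized_dihedral G\<^esub> (reflection y \<otimes>\<^bsub>generalized_dihedral G\<^esub>
        rotation (mprod G R \<otimes> inv (mprod G T')))
      \<in> seq_products (generalized_dihedral G)
          ({#reflection x#} + ({#reflection y#} + image_mset reflection (R + T')))"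
    using add.IH[of T'] add.prems(1) T carr
    by (intro dihedral_products) (auto simp: seq_over_def carrier_generalized_dihedral)
  moreover have "reflection x \<otimes>\<^bsub>generalized_dihedral G\<^esub> (reflection y \<otimes>\<^bsub>generalized_dihedral G\<^esub>
        rotation (mprod G R \<otimes> inv (mprod G T')))
      = rotation (mprod G (add_mset x R) \<otimes> inv (mprod G T))"
    unfolding T using carr by (simp add: dihedral_mult inv_mult_group m_ac)
  ultimately show ?case
    unfolding T by (simp add: ac_simps)
qed

text \<open>The ordering is \<open>P, r, Q, t\<close>, followed by the remaining reflections in turn, for some \<open>r \<in> R\<close>
  and \<open>t \<in> T\<close>.  The terms of \<open>Q\<close> are inverted by \<open>r\<close> alone, whereas two reflections stand before
  what follows \<open>t\<close>.\<close>

lemma balanced_imp_product_one: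
  assumes "balanced X Y m l" "1 \<le> l" "set_mset X \<subseteq> carrier G" "set_mset Y \<subseteq> carrier G"
  shows "\<one>\<^bsub>generalized_dihedral G\<^esub> \<in> subseq_products (generalized_dihedral G) (2 * m)
    (image_mset rotation X + image_mset reflection Y)"
proof -
  let ?D = "generalized_dihedral G"
  obtain P Q R T where b: "P + Q \<subseteq># X" "R + T \<subseteq># Y" "size R = l" "size T = l"
      "size P + size Q + 2 * l = 2 * m" "mprod G P \<otimes> mprod G R = mprod G Q \<otimes> mprod G T"
    using assms(1) unfolding balanced_def by blast
  obtain r R' where R: "R = add_mset r R'"
    using b(3) assms(2) by (cases R) auto
  obtain t T' where T: "T = add_mset t T'"
    using b(4) assms(2) by (cases T) auto
  have carr: "set_mset P \<subseteq> carrier G" "set_mset Q \<subseteq> carrier G" "set_mset R' \<subseteq> carrier G"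
      "set_mset T' \<subseteq> carrier G" "r \<in> carrier G" "t \<in> carrier G"
    using set_mset_mono[OF b(1)] set_mset_mono[OF b(2)] assms(3,4) R T by auto
  note [simp] = carr(1-4)[THEN mprod_closed]
  let ?M = "image_mset rotation (P + Q) + image_mset reflection (R + T)"
  let ?e = "rotation (mprod G P) \<otimes>\<^bsub>?D\<^esub> (reflection r \<otimes>\<^bsub>?D\<^esub> (rotation (mprod G Q) \<otimes>\<^bsub>?D\<^esub>
      (reflection t \<otimes>\<^bsub>?D\<^esub> rotation (mprod G R' \<otimes> inv (mprod G T')))))"
  have "?e \<in> seq_products ?D (image_mset rotation P + ({#reflection r#} +
      (image_mset rotation Q + ({#reflection t#} + image_mset reflection (R' + T')))))"
    using carr b(3,4) R T unfolding seq_over_union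
    by (intro dihedral_products rotation_products reflection_products)
      (auto simp: seq_over_def carrier_generalized_dihedral)
  then have M: "?e \<in> seq_products ?D ?M"
    unfolding R T by (simp add: ac_simps)
  have "?e = rotation ((mprod G P \<otimes> mprod G R) \<otimes> inv (mprod G Q \<otimes> mprod G T))"
    unfolding R T using carr by (simp add: dihedral_mult inv_mult_group m_ac)
  moreover have "mprod G Q \<otimes> mprod G T \<in> carrier G"
    unfolding T using carr by simp
  ultimately have "?e = \<one>\<^bsub>?D\<^esub>"
    unfolding b(6) dihedral_one by simp
  with M have "\<one>\<^bsub>?D\<^esub> \<in> seq_products ?D ?M"
    by (simp only:)
  moreover have "?M \<subseteq># image_mset rotation X + image_mset reflection Y"
    using b(1,2) by (intro subset_mset.add_mono image_mset_subseteq_mono)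
  moreover have "size ?M = 2 * m"
    using b(3-5) by simp
  ultimately show ?thesis
    unfolding subseq_products_def by auto
qed

lemma rotations_imp_product_one:
  assumes "T \<subseteq># X" "mprod G T = \<one>" "set_mset X \<subseteq> carrier G"
  shows "\<one>\<^bsub>generalized_dihedral G\<^esub> \<in> subseq_products (generalized_dihedral G) (size T)
    (image_mset rotation X + image_mset reflection Y)"
proof -
  have "\<one>\<^bsub>generalized_dihedral G\<^esub> \<in> seq_products (generalized_dihedral G) (image_mset rotation T)"
    using rotation_products[of T] set_mset_mono[OF assms(1)] assms(2,3) by (auto simp: dihedral_one)
  moreover have "image_mset rotation T \<subseteq># image_mset rotation X + image_mset reflection Y"
    by (rule subset_mset.order_trans[OF image_mset_subseteq_mono[OF assms(1)] mset_subset_eq_add_left])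
  ultimately show ?thesis
    unfolding subseq_products_def by (intro UN_I[of "image_mset rotation T"]) auto
qed

lemma split_rotations_reflections:
  assumes "seq_over (generalized_dihedral G) S"
  obtains X Y where "S = image_mset rotation X + image_mset reflection Y"
    "set_mset X \<subseteq> carrier G" "set_mset Y \<subseteq> carrier G"
proof -
  have "\<exists>X Y. S = image_mset rotation X + image_mset reflection Y \<and>
      set_mset X \<subseteq> carrier G \<and> set_mset Y \<subseteq> carrier G"
    using assms
  proof (induction S)
    case (add s S)
    then obtain X Y where XY: "S = image_mset rotation X + image_mset reflection Y"
        "set_mset X \<subseteq> carrier G" "set_mset Y \<subseteq> carrier G"
      by (auto simp: seq_over_def)
    obtain a where a: "a \<in> carrier G" "s = rotation a \<or> s = reflection a"
      using add.prems by (auto simp: seq_over_def carrier_generalized_dihedral)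
    from a(2) show ?case
    proof
      assume "s = rotation a"
      then show ?thesis
        using XY a(1) by (intro exI[of _ "add_mset a X"] exI[of _ Y]) simp
    next
      assume "s = reflection a"
      then show ?thesis
        using XY a(1) by (intro exI[of _ X] exI[of _ "add_mset a Y"]) simp
    qed
  qed simp
  then show ?thesis
    using that by blast
qed

lemma gao_bound_generalized_dihedral:
  assumes "finite (carrier G)"
  shows "gao_bound (generalized_dihedral G) (3 * order G)"
  unfolding gao_bound_def
proof (intro allI impI, elim conjE)
  let ?D = "generalized_dihedral G"
  fix S assume S: "seq_over ?D S" "3 * order G \<le> size S"
  obtain S' where S': "S' \<subseteq># S" "size S' = 3 * order G"
    using ex_subset_mset_size[OF S(2)] by blast
  have "seq_over ?D S'"
    using S(1) set_mset_mono[OF S'(1)] by (auto simp: seq_over_def)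
  then obtain X Y where XY: "S' = image_mset rotation X + image_mset reflection Y"
      "set_mset X \<subseteq> carrier G" "set_mset Y \<subseteq> carrier G"
    by (rule split_rotations_reflections)
  have "size X + size Y = 3 * order G"
    using S'(2) XY(1) by simp
  from full_or_balanced[OF assms XY(2,3) this]
  have "\<one>\<^bsub>?D\<^esub> \<in> subseq_products ?D (2 * order G) S'"
    unfolding XY(1) using rotations_imp_product_one[OF _ _ XY(2)]
      balanced_imp_product_one[OF _ _ XY(2,3)] by metis
  then show "\<one>\<^bsub>?D\<^esub> \<in> subseq_products ?D (order ?D) S"
    unfolding order_generalized_dihedral subseq_products_def
    using S'(1) subset_mset.order_trans by blast
qed

end

theorem theorem1p3:
  fixes p :: nat and A :: "('a, 'b) monoid_scheme"
  assumes "Factorial_Ring.prime p"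
    and "comm_group A" and "finite (carrier A)" and "p_group p A"
  shows "real (gao_constant (generalized_dihedral A))
           \<le> 3 / 2 * real (order (generalized_dihedral A))"
proof -
  interpret comm_group A by fact
  have "gao_constant (generalized_dihedral A) \<le> 3 * order A"
    by (rule gao_constant_le[OF gao_bound_generalized_dihedral[OF assms(3)]])
  then show ?thesis
    unfolding order_generalized_dihedral by simp
qed

end
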